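(* Let $G=(V,E)$ be a finite simple graph with $n=|V|$ vertices and let $\zeta:V\to\{1,\ldots,n\}$ be a bijection (a labeling of the vertices). Define the chromatic quasisymmetric function \[ \mathbf{X}_{G,\zeta}(\mathbf{x},t)=\sum_{\kappa}t^{\mathrm{asc}(\kappa)}\prod_{v\in V}x_{\kappa(v)},\] summed over proper colorings $\kappa:V\to\mathbb{Z}_{>0}$ of $G$, where $\mathrm{asc}(\kappa)=|\{\{u,v\}\in E:\zeta(u)<\zeta(v)\text{ and }\kappa(u)<\kappa(v)\}|$. Expand $\mathbf{X}_{G,\zeta}(\mathbf{x},t)=\sum_{S\subseteq[n-1]} d_S(t)\,F_S$ in the basis of fundamental quasisymmetric functions, and for $1\le k\le n$ let $d_{\lambda^{(k)}}(t)$ denote the coefficient $d_S(t)$ for $S=\{k,k+1,\ldots,n-1\}$ (the descent set corresponding to the hook composition $(k,1,\ldots,1)$). Then \[ d_{\lambda^{(k)}}(t)=\sum_{\mathfrak{o}\in O(G)}\binom{\mathrm{snk}(\mathfrak{o})-1}{k-1}\, t^{\mathrm{des}(\mathfrak{o})},\] where $O(G)$ is the set of acyclic orientations of $G$, $\mathrm{snk}(\mathfrak{o})$ is the number of sinks of $\mathfrak{o}$, and $\mathrm{des}(\mathfrak{o})$ is the number of directed edges $(u,v)$ of $\mathfrak{o}$ (directed from $u$ to $v$) with $\zeta(u)>\zeta(v)$.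
   Context: A simple graph has no loops and no multiple edges. A proper coloring assigns positive integers to vertices so that adjacent vertices receive different values. For $S\subseteq[n-1]=\{1,\ldots,n-1\}$, the (Gessel) fundamental quasisymmetric function is $F_S=\sum x_{i_1}x_{i_2}\cdots x_{i_n}$, summed over all $i_1\le i_2\le\cdots\le i_n$ of positive integers such that $i_j<i_{j+1}$ whenever $j\in S$. An orientation is acyclic if it has no directed cycle; a sink is a vertex with no edges directed away from it (isolated vertices are sinks). Binomial coefficients $\binom{a}{b}$ with $a<b$ are $0$. *)

theory Defs
  imports
    "HOL-Library.Poly_Mapping"
    "HOL-Library.FuncSet"
    "HOL-Computational_Algebra.Polynomial"
begin

section \<open>Formal power series in the variables $x_1, x_2, \dots$\<close>

text \<open>
  A monomial is its exponent vector, of type \<^typ>\<open>nat \<Rightarrow>\<^sub>0 nat\<close>; a formal power series with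
  coefficients in \<open>'b\<close> is its coefficient function \<open>(nat \<Rightarrow>\<^sub>0 nat) \<Rightarrow> 'b\<close>.
  The variable with index 0 never occurs below.
\<close>

definition var_prod :: "'i set \<Rightarrow> ('i \<Rightarrow> nat) \<Rightarrow> (nat \<Rightarrow>\<^sub>0 nat)" where
  "var_prod I f = (\<Sum>i\<in>I. Poly_Mapping.single (f i) 1)"

text \<open>
  The possibly infinite formal sum, over \<open>c \<in> C\<close>, of \<open>w c\<close> times the product of the variables
  \<open>x\<^bsub>c i\<^esub>\<close> for \<open>i \<in> I\<close>.  It is meaningful because only finitely many \<open>c\<close> contribute to
  any given monomial; see \<open>finite_var_prod_fibre\<close>.
\<close>

definition formal_sum ::
    "'i set \<Rightarrow> ('i \<Rightarrow> nat) set \<Rightarrow> (('i \<Rightarrow> nat) \<Rightarrow> 'b::comm_semiring_1) \<Rightarrow> (nat \<Rightarrow>\<^sub>0 nat) \<Rightarrow> 'b" where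
  "formal_sum I C w = (\<lambda>m. \<Sum>c | c \<in> C \<and> var_prod I c = m. w c)"

lemma finite_var_prod_fibre:
  assumes "finite I" "C \<subseteq> I \<rightarrow>\<^sub>E A"
  shows "finite {c. c \<in> C \<and> var_prod I c = m}"
proof (rule finite_subset)
  show "finite (I \<rightarrow>\<^sub>E Poly_Mapping.keys m)"
    using assms(1) by (intro finite_PiE) auto
  have "c i \<in> Poly_Mapping.keys (var_prod I c)" if "i \<in> I" for c i
  proof -
    have "Poly_Mapping.lookup (var_prod I c) (c i) = (\<Sum>j\<in>I. if c j = c i then 1 else (0::nat))"
      unfolding var_prod_def
      by (simp add: Poly_Mapping.lookup_sum Poly_Mapping.lookup_single when_def cong: if_cong)
    also have "\<dots> \<noteq> 0"
      using assms(1) that by auto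
    finally show ?thesis
      by (simp add: Poly_Mapping.in_keys_iff)
  qed
  then show "{c. c \<in> C \<and> var_prod I c = m} \<subseteq> I \<rightarrow>\<^sub>E Poly_Mapping.keys m"
    using assms(2) by (fastforce simp: PiE_iff subset_iff)
qed

section \<open>Fundamental quasisymmetric functions\<close>

definition fundamental_seqs :: "nat \<Rightarrow> nat set \<Rightarrow> (nat \<Rightarrow> nat) set" where
  "fundamental_seqs n S =
     {i \<in> {1..n} \<rightarrow>\<^sub>E {1..}. mono_on {1..n} i \<and> (\<forall>j\<in>S. i j < i (Suc j))}"

definition fundamental_qsym :: "nat \<Rightarrow> nat set \<Rightarrow> (nat \<Rightarrow>\<^sub>0 nat) \<Rightarrow> 'b::comm_semiring_1" where
  "fundamental_qsym n S = formal_sum {1..n} (fundamental_seqs n S) (\<lambda>_. 1)"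

definition fundamental_expansion ::
    "nat \<Rightarrow> ((nat \<Rightarrow>\<^sub>0 nat) \<Rightarrow> 'b::comm_semiring_1) \<Rightarrow> (nat set \<Rightarrow> 'b) \<Rightarrow> bool" where
  "fundamental_expansion n X d \<longleftrightarrow>
     X = (\<lambda>m. \<Sum>S\<in>Pow {1..n - 1}. d S * fundamental_qsym n S m)"

section \<open>Graphs, colorings and the chromatic quasisymmetric function\<close>

definition finite_simple_graph :: "'a set \<Rightarrow> 'a set set \<Rightarrow> bool" where
  "finite_simple_graph V E \<longleftrightarrow> finite V \<and> (\<forall>e\<in>E. e \<subseteq> V \<and> card e = 2)"

definition proper_colorings :: "'a set \<Rightarrow> 'a set set \<Rightarrow> ('a \<Rightarrow> nat) set" where
  "proper_colorings V E =
     {\<kappa> \<in> V \<rightarrow>\<^sub>E {1..}. \<forall>u v. {u, v} \<in> E \<longrightarrow> \<kappa> u \<noteq> \<kappa> v}"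

definition asc :: "'a set set \<Rightarrow> ('a \<Rightarrow> nat) \<Rightarrow> ('a \<Rightarrow> nat) \<Rightarrow> nat" where
  "asc E \<zeta> \<kappa> = card {e \<in> E. \<exists>u v. e = {u, v} \<and> \<zeta> u < \<zeta> v \<and> \<kappa> u < \<kappa> v}"

text \<open>The indeterminate $t$ is the variable of \<^typ>\<open>int poly\<close>; $t^j$ is \<open>monom 1 j\<close>.\<close>

definition chromatic_qsym ::
    "'a set \<Rightarrow> 'a set set \<Rightarrow> ('a \<Rightarrow> nat) \<Rightarrow> (nat \<Rightarrow>\<^sub>0 nat) \<Rightarrow> int poly" where
  "chromatic_qsym V E \<zeta> = formal_sum V (proper_colorings V E) (\<lambda>\<kappa>. monom 1 (asc E \<zeta> \<kappa>))"

section \<open>Acyclic orientations\<close>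

text \<open>An orientation is the set of its directed edges; \<open>(u, v)\<close> is directed from \<open>u\<close> to \<open>v\<close>.\<close>

definition orientation :: "'a set set \<Rightarrow> ('a \<times> 'a) set \<Rightarrow> bool" where
  "orientation E D \<longleftrightarrow>
     (\<forall>(u, v)\<in>D. {u, v} \<in> E) \<and>
     (\<forall>u v. {u, v} \<in> E \<longrightarrow> ((u, v) \<in> D \<longleftrightarrow> (v, u) \<notin> D))"

definition acyclic_orientations :: "'a set set \<Rightarrow> ('a \<times> 'a) set set" where
  "acyclic_orientations E = {D. orientation E D \<and> acyclic D}"

definition snk :: "'a set \<Rightarrow> ('a \<times> 'a) set \<Rightarrow> nat" where
  "snk V D = card {v \<in> V. \<forall>w. (v, w) \<notin> D}"

definition des :: "('a \<Rightarrow> nat) \<Rightarrow> ('a \<times> 'a) set \<Rightarrow> nat" where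
  "des \<zeta> D = card {(u, v) \<in> D. \<zeta> u > \<zeta> v}"

end

theory Submission
  imports Defs
begin

text \<open>
  The coefficient of $F_S$ at the monomial of a weakly increasing sequence is 1 or 0 according to
  whether \<open>S\<close> is contained in the set of strict ascents of the sequence.  As the coefficients of the
  chromatic quasisymmetric function depend only on that set, the expansion exists, is unique, and
  is given by Moebius inversion over subsets.  For \<open>S = {k, ..., n - 1}\<close> this writes the coefficient
  as a sum over colorings with color set \<open>{1, ..., l}\<close> and at least \<open>k\<close> vertices of color 1, each
  with sign \<open>(-1)^(n - k - l + 1)\<close>.

  Orient every edge towards its smaller color, and fix the orientation.  The vertices of color 1
  then form a set of sinks \<open>A\<close>, and the signed number of ways to color the other vertices is
  \<open>(-1)^(n - card A)\<close>, by induction.  What remains is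
  \<open>\<Sum> (-1)^(card A - k)\<close> over the sets \<open>A\<close> of at least \<open>k\<close> sinks, which is a single binomial coefficient.
\<close>

section \<open>Weakly increasing sequences and the fundamental basis\<close>

lemma lookup_var_prod:
  assumes "finite I"
  shows "Poly_Mapping.lookup (var_prod I f) x = count (image_mset f (mset_set I)) x"
  using assms unfolding var_prod_def
  by (induction I rule: finite_induct) (auto simp: lookup_add lookup_single when_def)

lemma var_prod_eq_iff:
  assumes "finite I" "finite J"
  shows "var_prod I f = var_prod J g \<longleftrightarrow> image_mset f (mset_set I) = image_mset g (mset_set J)"
  using assms by (simp add: poly_mapping_eq_iff fun_eq_iff lookup_var_prod multiset_eq_iff)

lemma var_prod_eq_imp_image_eq:
  assumes "finite I" "finite J" "var_prod I f = var_prod J g"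
  shows "f ` I = g ` J"
proof -
  have "set_mset (image_mset f (mset_set I)) = set_mset (image_mset g (mset_set J))"
    using assms by (simp add: var_prod_eq_iff)
  then show ?thesis
    using assms by simp
qed

lemma var_prod_eq_imp_card_fibre_eq:
  assumes "finite I" "finite J" "var_prod I f = var_prod J g"
  shows "card {i \<in> I. f i = x} = card {j \<in> J. g j = x}"
proof -
  have "count (image_mset f (mset_set I)) x = count (image_mset g (mset_set J)) x"
    using assms by (simp add: var_prod_eq_iff)
  then show ?thesis
    using assms by (simp add: count_image_mset' Collect_conj_eq[symmetric] eq_commute conj_commute)
qed

text \<open>Applying \<open>h\<close> to all values substitutes one variable for another in the
  monomial, so equal monomials stay equal. Asking for agreement with \<open>h\<close> only on the
  index sets makes this usable for functions restricted to \<open>V\<close>.\<close>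

lemma var_prod_eq_compose:
  assumes "finite I" "finite J" "var_prod I f = var_prod J g"
    and "\<And>i. i \<in> I \<Longrightarrow> f' i = h (f i)" "\<And>j. j \<in> J \<Longrightarrow> g' j = h (g j)"
  shows "var_prod I f' = var_prod J g'"
proof -
  have "image_mset f' (mset_set I) = image_mset h (image_mset f (mset_set I))"
    using assms(1,4) by (auto simp: multiset.map_comp intro!: image_mset_cong)
  also have "\<dots> = image_mset h (image_mset g (mset_set J))"
    using assms(1-3) by (simp add: var_prod_eq_iff)
  also have "\<dots> = image_mset g' (mset_set J)"
    using assms(2,5) by (auto simp: multiset.map_comp intro!: image_mset_cong)
  finally show ?thesis
    using assms(1,2) by (simp add: var_prod_eq_iff)
qed

section \<open>Weakly increasing sequences as representatives of monomials\<close>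

abbreviation weak_seqs :: "nat \<Rightarrow> (nat \<Rightarrow> nat) set" where
  "weak_seqs n \<equiv> fundamental_seqs n {}"

definition strict_steps :: "nat \<Rightarrow> (nat \<Rightarrow> nat) \<Rightarrow> nat set" where
  "strict_steps n i = {j \<in> {1..n - 1}. i j < i (Suc j)}"

lemma strict_steps_subset: "strict_steps n i \<subseteq> {1..n - 1}"
  by (auto simp: strict_steps_def)

lemma weak_seqs_mono:
  assumes "i \<in> weak_seqs n" "j \<le> j'" "1 \<le> j" "j' \<le> n"
  shows "i j \<le> i j'"
  using assms by (auto simp: fundamental_seqs_def mono_on_def)

lemma fundamental_seqs_iff:
  assumes "S \<subseteq> {1..n - 1}"
  shows "i \<in> fundamental_seqs n S \<longleftrightarrow> i \<in> weak_seqs n \<and> S \<subseteq> strict_steps n i"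
  using assms by (auto simp: fundamental_seqs_def strict_steps_def)

lemma mset_map_upt: "mset (map i [1..<Suc n]) = image_mset i (mset_set {1..n})"
  by (simp only: mset_map mset_upt atLeastLessThanSuc_atLeastAtMost)

text \<open>A sorted list is determined by its multiset of entries, and extensionality fixes the
  values outside \<open>{1..n}\<close>.\<close>

lemma weak_seqs_eqI:
  assumes "i \<in> weak_seqs n" "i' \<in> weak_seqs n" "var_prod {1..n} i = var_prod {1..n} i'"
  shows "i = i'"
proof -
  have srt: "sorted (map f [1..<Suc n])" if "f \<in> weak_seqs n" for f
    using that
    by (force simp: sorted_iff_nth_mono simp del: upt_Suc intro!: weak_seqs_mono[OF that])
  have "mset (map i [1..<Suc n]) = mset (map i' [1..<Suc n])"
    using assms(3) unfolding mset_map_upt by (simp add: var_prod_eq_iff)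
  then have "map i [1..<Suc n] = map i' [1..<Suc n]"
    using srt assms(1,2) by (metis properties_for_sort)
  then have "\<forall>j\<in>{1..n}. i j = i' j"
    by (auto simp del: upt_Suc)
  moreover have "i \<in> extensional {1..n}" "i' \<in> extensional {1..n}"
    using assms(1,2) by (auto simp: fundamental_seqs_def PiE_iff)
  ultimately show ?thesis
    by (blast intro: extensionalityI)
qed

text \<open>Sorting the values of \<open>f\<close> gives the sequence. With
  \<open>weak_seqs_eqI\<close> it is the only one with this monomial.\<close>

lemma ex_weak_seq:
  assumes "finite I" "card I = n" "\<And>v. v \<in> I \<Longrightarrow> 1 \<le> f v"
  shows "\<exists>i\<in>weak_seqs n. var_prod I f = var_prod {1..n} i"
proof -
  define xs where "xs = sorted_list_of_multiset (image_mset f (mset_set I))"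
  have mset_xs: "mset xs = image_mset f (mset_set I)"
    by (simp add: xs_def)
  have len: "length xs = n"
    using assms(2) mset_xs by (metis size_image_mset size_mset size_mset_set)
  have set_xs: "set xs = f ` I"
    using assms(1) mset_xs by (metis finite_set_mset_mset_set set_image_mset set_mset_mset)
  have srt: "sorted xs"
    by (simp add: xs_def)
  \<comment> \<open>Lists are indexed from 0 and sequences from 1, hence the shift.\<close>
  define i where "i = (\<lambda>j\<in>{1..n}. xs ! (j - 1))"
  have "xs ! (j - 1) \<ge> 1" if "j \<in> {1..n}" for j
  proof -
    have "xs ! (j - 1) \<in> set xs"
      using that len by (intro nth_mem) auto
    then show ?thesis
      using set_xs assms(3) by auto
  qed
  moreover have "mono_on {1..n} i"
    using srt len by (auto simp: mono_on_def i_def sorted_iff_nth_mono)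
  ultimately have "i \<in> weak_seqs n"
    by (auto simp: fundamental_seqs_def i_def)
  moreover have "map i [1..<Suc n] = xs"
    using len by (auto simp: list_eq_iff_nth_eq i_def simp del: upt_Suc)
  then have "image_mset i (mset_set {1..n}) = image_mset f (mset_set I)"
    using mset_map_upt[of i n] mset_xs by simp
  ultimately show ?thesis
    using assms(1) by (metis finite_atLeastAtMost var_prod_eq_iff)
qed

text \<open>The only weakly increasing sequence with this monomial is \<open>i\<close> itself, so
  the sum has one term or none.\<close>

lemma fundamental_qsym_var_prod:
  assumes "S \<subseteq> {1..n - 1}" "i \<in> weak_seqs n"
  shows "fundamental_qsym n S (var_prod {1..n} i) = (if S \<subseteq> strict_steps n i then 1 else 0)"
proof -
  have "c \<in> fundamental_seqs n S \<and> var_prod {1..n} c = var_prod {1..n} i \<longleftrightarrow>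
      S \<subseteq> strict_steps n i \<and> c = i" for c
    using assms by (metis fundamental_seqs_iff weak_seqs_eqI)
  then have "{c \<in> fundamental_seqs n S. var_prod {1..n} c = var_prod {1..n} i} =
      (if S \<subseteq> strict_steps n i then {i} else {})"
    by (simp del: One_nat_def)
  then show ?thesis
    by (simp add: fundamental_qsym_def formal_sum_def)
qed

lemma fundamental_qsym_eq_0:
  assumes "S \<subseteq> {1..n - 1}" "m \<notin> var_prod {1..n} ` weak_seqs n"
  shows "fundamental_qsym n S m = 0"
proof -
  have "{c \<in> fundamental_seqs n S. var_prod {1..n} c = m} = {}"
    using assms fundamental_seqs_iff by blast
  then show ?thesis
    by (simp only: fundamental_qsym_def formal_sum_def sum.empty)
qed

text \<open>This replaces an identity of power series by a linear system for \<open>d\<close>. Every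
  fundamental function vanishes at the other monomials, and at the monomial of \<open>i\<close>
  exactly those with \<open>S\<close> inside the strict steps contribute, each with coefficient
  1.\<close>

lemma fundamental_expansion_iff:
  "fundamental_expansion n X d \<longleftrightarrow>
     (\<forall>m. m \<notin> var_prod {1..n} ` weak_seqs n \<longrightarrow> X m = 0) \<and>
     (\<forall>i\<in>weak_seqs n. X (var_prod {1..n} i) = sum d (Pow (strict_steps n i)))"
proof -
  have outside: "(\<Sum>S\<in>Pow {1..n - 1}. d S * fundamental_qsym n S m) = 0"
    if "m \<notin> var_prod {1..n} ` weak_seqs n" for m
    using that by (intro sum.neutral) (simp add: fundamental_qsym_eq_0)
  have inside: "(\<Sum>S\<in>Pow {1..n - 1}. d S * fundamental_qsym n S (var_prod {1..n} i)) =
      sum d (Pow (strict_steps n i))" if "i \<in> weak_seqs n" for i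
  proof -
    have "(\<Sum>S\<in>Pow {1..n - 1}. d S * fundamental_qsym n S (var_prod {1..n} i)) =
        (\<Sum>S\<in>Pow {1..n - 1}. if S \<in> Pow (strict_steps n i) then d S else 0)"
      using that by (intro sum.cong) (auto simp: fundamental_qsym_var_prod simp del: One_nat_def)
    also have "\<dots> = sum d (Pow {1..n - 1} \<inter> Pow (strict_steps n i))"
      by (simp add: sum.inter_restrict)
    also have "Pow {1..n - 1} \<inter> Pow (strict_steps n i) = Pow (strict_steps n i)"
      using strict_steps_subset[of n i] by auto
    finally show ?thesis .
  qed
  have split: "(\<forall>m. Q m) \<longleftrightarrow>
      (\<forall>m. m \<notin> var_prod {1..n} ` weak_seqs n \<longrightarrow> Q m) \<and> (\<forall>i\<in>weak_seqs n. Q (var_prod {1..n} i))" for Q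
    by (metis image_iff)
  have "fundamental_expansion n X d \<longleftrightarrow>
      (\<forall>m. m \<notin> var_prod {1..n} ` weak_seqs n \<longrightarrow>
         X m = (\<Sum>S\<in>Pow {1..n - 1}. d S * fundamental_qsym n S m)) \<and>
      (\<forall>i\<in>weak_seqs n.
         X (var_prod {1..n} i) = (\<Sum>S\<in>Pow {1..n - 1}. d S * fundamental_qsym n S (var_prod {1..n} i)))"
    unfolding fundamental_expansion_def fun_eq_iff by (rule split)
  also have "\<dots> \<longleftrightarrow>
      (\<forall>m. m \<notin> var_prod {1..n} ` weak_seqs n \<longrightarrow> X m = 0) \<and>
      (\<forall>i\<in>weak_seqs n. X (var_prod {1..n} i) = sum d (Pow (strict_steps n i)))"
    by (intro arg_cong2[where f = "(\<and>)"] all_cong1 imp_cong ball_cong refl)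
       (simp_all add: outside inside del: One_nat_def)
  finally show ?thesis .
qed

section \<open>Packed sequences: the gap-free representative of each set of strict steps\<close>

definition packed_seq :: "nat \<Rightarrow> nat set \<Rightarrow> nat \<Rightarrow> nat" where
  "packed_seq n T = (\<lambda>j\<in>{1..n}. Suc (card (T \<inter> {1..<j})))"

lemma packed_seq_Suc:
  assumes "j \<in> {1..<n}"
  shows "packed_seq n T (Suc j) = packed_seq n T j + (if j \<in> T then 1 else 0)"
proof -
  have "T \<inter> {1..<Suc j} = (if j \<in> T then insert j (T \<inter> {1..<j}) else T \<inter> {1..<j})"
    using assms by (auto simp: less_Suc_eq)
  then show ?thesis
    using assms by (simp add: packed_seq_def)
qed

lemma packed_seq_in_weak_seqs: "packed_seq n T \<in> weak_seqs n"
  by (auto simp: fundamental_seqs_def packed_seq_def mono_on_def intro!: card_mono)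

lemma strict_steps_packed_seq:
  assumes "T \<subseteq> {1..n - 1}"
  shows "strict_steps n (packed_seq n T) = T"
proof -
  have "packed_seq n T j < packed_seq n T (Suc j) \<longleftrightarrow> j \<in> T" if "j \<in> {1..n - 1}" for j
    using that packed_seq_Suc[of j n T] by (auto split: if_splits)
  then show ?thesis
    using assms by (auto simp: strict_steps_def)
qed

text \<open>All comparisons between values are thus determined by the strict steps alone, which is
  the source of quasisymmetry. For \<open>j' \<le> j\<close> the interval is empty and monotonicity
  rules out the left side.\<close>

lemma weak_seqs_less_iff:
  assumes "i \<in> weak_seqs n" "j \<in> {1..n}" "j' \<in> {1..n}"
  shows "i j < i j' \<longleftrightarrow> strict_steps n i \<inter> {j..<j'} \<noteq> {}"
proof
  assume "strict_steps n i \<inter> {j..<j'} \<noteq> {}"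
  then obtain l where l: "l \<in> strict_steps n i" "j \<le> l" "l < j'"
    by auto
  have "i j \<le> i l" "i (Suc l) \<le> i j'"
    using l assms by (auto intro!: weak_seqs_mono[OF assms(1)])
  then show "i j < i j'"
    using l by (auto simp: strict_steps_def)
next
  assume less: "i j < i j'"
  show "strict_steps n i \<inter> {j..<j'} \<noteq> {}"
  proof
    assume empty: "strict_steps n i \<inter> {j..<j'} = {}"
    have "j < j'"
      using less weak_seqs_mono[OF assms(1), of j' j] assms by (cases "j' \<le> j") auto
    have "i l \<le> i j" if "j \<le> l" "l \<le> j'" for l
      using that
    proof (induction l rule: dec_induct)
      case (step l)
      have "l \<notin> strict_steps n i"
        using empty step by auto
      then have "i (Suc l) \<le> i l"
        using step assms by (auto simp: strict_steps_def)
      then show ?case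
        using step by simp
    qed simp
    from this[of j'] show False
      using less \<open>j < j'\<close> by simp
  qed
qed

text \<open>Without gaps in the image, the sequence must start at 1 and rise by exactly one at each
  strict step.\<close>

lemma packed_seq_eqI:
  assumes "i \<in> weak_seqs n" "i ` {1..n} = {1..l}"
  shows "i = packed_seq n (strict_steps n i)"
proof -
  have "i j = packed_seq n (strict_steps n i) j" if "1 \<le> j" "j \<le> n" for j
    using that
  proof (induction j rule: dec_induct)
    case base
    have "1 \<in> i ` {1..n}"
      using assms(2) base by (metis atLeastAtMost_iff image_is_empty atLeastatMost_empty_iff2 le_refl)
    then obtain j where "j \<in> {1..n}" "i j = 1"
      by auto
    then have "i 1 \<le> 1"
      using weak_seqs_mono[OF assms(1), of 1 j] by auto
    moreover have "i 1 \<in> {1..l}"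
      using assms(2) base by auto
    ultimately show ?case
      using base by (simp add: packed_seq_def)
  next
    case (step j)
    have "i (Suc j) = i j + (if j \<in> strict_steps n i then 1 else 0)"
    proof (cases "i j < i (Suc j)")
      case True
      \<comment> \<open>The next value is attained somewhere, necessarily after position
        \<open>j\<close>; monotonicity then bounds the value at \<open>Suc j\<close> by it.\<close>
      then have "Suc (i j) \<in> i ` {1..n}"
        using assms(2) step by (metis Suc_leI atLeastAtMost_iff image_eqI le_SucI linorder_not_le order_trans not_less_eq_eq)
      then obtain j' where j': "j' \<in> {1..n}" "i j' = Suc (i j)"
        by auto
      have "Suc j \<le> j'"
        using weak_seqs_mono[OF assms(1), of j' j] j' step by (cases "Suc j \<le> j'") auto
      then have "i (Suc j) \<le> Suc (i j)"
        using weak_seqs_mono[OF assms(1), of "Suc j" j'] j' by auto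
      then show ?thesis
        using True step by (auto simp: strict_steps_def)
    next
      case False
      then show ?thesis
        using weak_seqs_mono[OF assms(1), of j "Suc j"] step by (auto simp: strict_steps_def)
    qed
    then show ?case
      using step packed_seq_Suc[of j n "strict_steps n i"] by simp
  qed
  moreover have "i \<in> extensional {1..n}"
    using assms(1) by (auto simp: fundamental_seqs_def PiE_iff)
  moreover have "packed_seq n (strict_steps n i) \<in> extensional {1..n}"
    by (simp add: packed_seq_def)
  ultimately show ?thesis
    by (intro extensionalityI[of _ "{1..n}"]) auto
qed

lemma packed_seq_image:
  assumes "T \<subseteq> {1..n - 1}" "1 \<le> n"
  shows "packed_seq n T ` {1..n} = {1..Suc (card T)}"
proof -
  have *: "packed_seq n T ` {1..j} = {1..Suc (card (T \<inter> {1..<j}))}" if "1 \<le> j" "j \<le> n" for j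
    using that
  proof (induction j rule: dec_induct)
    case base
    then show ?case by (simp add: packed_seq_def)
  next
    case (step j)
    have "packed_seq n T ` {1..Suc j} = insert (packed_seq n T (Suc j)) (packed_seq n T ` {1..j})"
      by (simp add: atLeastAtMostSuc_conv)
    also have "\<dots> = {1..packed_seq n T (Suc j)}"
      using step packed_seq_Suc[of j n T] by (auto simp: packed_seq_def)
    finally show ?case
      using step by (simp add: packed_seq_def)
  qed
  have "T \<inter> {1..<n} = T"
    using assms by fastforce
  then show ?thesis
    using *[of n] assms by simp
qed

text \<open>The value 1 persists up to and including the least element of \<open>T\<close>. So a
  first block of size at least \<open>k\<close> singles out the subsets of the hook descent set,
  over which Moebius inversion will sum.\<close>

lemma packed_seq_first_block:
  assumes "T \<subseteq> {1..n - 1}" "1 \<le> k" "k \<le> n"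
  shows "k \<le> card {j \<in> {1..n}. packed_seq n T j = 1} \<longleftrightarrow> T \<subseteq> {k..n - 1}"
proof -
  have fin: "finite T"
    using assms(1) finite_subset by blast
  have eq: "{j \<in> {1..n}. packed_seq n T j = 1} = {j \<in> {1..n}. T \<inter> {1..<j} = {}}"
    using fin by (auto simp: packed_seq_def)
  show ?thesis
  proof
    assume "T \<subseteq> {k..n - 1}"
    then have "{1..k} \<subseteq> {j \<in> {1..n}. T \<inter> {1..<j} = {}}"
      using assms by fastforce
    then have "card {1..k} \<le> card {j \<in> {1..n}. T \<inter> {1..<j} = {}}"
      by (intro card_mono) auto
    then show "k \<le> card {j \<in> {1..n}. packed_seq n T j = 1}"
      unfolding eq by simp
  next
    assume le: "k \<le> card {j \<in> {1..n}. packed_seq n T j = 1}"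
    have "k \<le> t" if "t \<in> T" for t
    proof -
      have "{j \<in> {1..n}. T \<inter> {1..<j} = {}} \<subseteq> {1..t}"
        using that assms(1) by (force simp: disjoint_iff)
      then have "card {j \<in> {1..n}. T \<inter> {1..<j} = {}} \<le> card {1..t}"
        by (intro card_mono) auto
      then show ?thesis
        using le unfolding eq by simp
    qed
    then show "T \<subseteq> {k..n - 1}"
      using assms(1) by auto
  qed
qed

section \<open>Quasisymmetry of the chromatic quasisymmetric function\<close>

lemma finite_simple_graph_edge_subset:
  assumes "finite_simple_graph V E" "{u, v} \<in> E"
  shows "u \<in> V" "v \<in> V" "u \<noteq> v"
  using assms by (fastforce simp: finite_simple_graph_def)+

lemma proper_colorings_subset: "proper_colorings V E \<subseteq> V \<rightarrow>\<^sub>E {1..}"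
  by (auto simp: proper_colorings_def)

text \<open>The colors of \<kappa> are the values of \<open>i\<close>, and renaming them to the
  values of \<open>i'\<close> preserves their order because the strict steps agree. Properness and
  the ascent count depend only on that order.\<close>

lemma relabel_coloring:
  fixes \<phi> :: "nat \<Rightarrow> nat" and \<kappa> :: "'a \<Rightarrow> nat"
  assumes graph: "finite_simple_graph V E" and n: "card V = n"
    and i: "i \<in> weak_seqs n" and i': "i' \<in> weak_seqs n"
    and steps: "strict_steps n i = strict_steps n i'"
    and \<phi>: "\<And>j. j \<in> {1..n} \<Longrightarrow> \<phi> (i j) = i' j"
    and \<kappa>: "\<kappa> \<in> proper_colorings V E" "var_prod V \<kappa> = var_prod {1..n} i"
  defines "\<kappa>' \<equiv> \<lambda>v\<in>V. \<phi> (\<kappa> v)"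
  shows "\<kappa>' \<in> proper_colorings V E" "var_prod V \<kappa>' = var_prod {1..n} i'"
    and "asc E \<zeta> \<kappa>' = asc E \<zeta> \<kappa>"
proof -
  have fin: "finite V"
    using graph by (simp add: finite_simple_graph_def)
  have im: "\<kappa> ` V = i ` {1..n}"
    using var_prod_eq_imp_image_eq[OF fin _ \<kappa>(2)] by simp
  have ex: "\<exists>j\<in>{1..n}. \<kappa> v = i j \<and> \<kappa>' v = i' j" if "v \<in> V" for v
  proof -
    have "\<kappa> v \<in> i ` {1..n}"
      using that im by auto
    then show ?thesis
      using \<phi> that by (auto simp: \<kappa>'_def)
  qed
  have less: "\<kappa>' u < \<kappa>' v \<longleftrightarrow> \<kappa> u < \<kappa> v" if uv: "u \<in> V" "v \<in> V" for u v
  proof -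
    obtain j l where jl: "j \<in> {1..n}" "\<kappa> u = i j" "\<kappa>' u = i' j"
        "l \<in> {1..n}" "\<kappa> v = i l" "\<kappa>' v = i' l"
      using ex[OF uv(1)] ex[OF uv(2)] by auto
    then show ?thesis
      using weak_seqs_less_iff[OF i jl(1,4)] weak_seqs_less_iff[OF i' jl(1,4)] steps by simp
  qed
  have "\<kappa>' \<in> V \<rightarrow>\<^sub>E {1..}"
  proof (rule PiE_I)
    fix v assume "v \<in> V"
    then obtain j where "j \<in> {1..n}" "\<kappa>' v = i' j"
      using ex by blast
    then show "\<kappa>' v \<in> {1..}"
      using i' by (auto simp: fundamental_seqs_def)
  qed (simp add: \<kappa>'_def)
  moreover have "\<kappa>' u \<noteq> \<kappa>' v" if "{u, v} \<in> E" for u v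
  proof -
    have "\<kappa> u \<noteq> \<kappa> v"
      using that \<kappa>(1) by (auto simp: proper_colorings_def)
    then show ?thesis
      using less[of u v] less[of v u] finite_simple_graph_edge_subset[OF graph that]
      by (metis linorder_neqE_nat less_irrefl_nat)
  qed
  ultimately show "\<kappa>' \<in> proper_colorings V E"
    by (auto simp: proper_colorings_def)
  show "var_prod V \<kappa>' = var_prod {1..n} i'"
    using \<phi> by (intro var_prod_eq_compose[OF fin _ \<kappa>(2), of \<kappa>' \<phi>]) (auto simp: \<kappa>'_def)
  have "(\<exists>u v. e = {u, v} \<and> \<zeta> u < \<zeta> v \<and> \<kappa>' u < \<kappa>' v) \<longleftrightarrow>
      (\<exists>u v. e = {u, v} \<and> \<zeta> u < \<zeta> v \<and> \<kappa> u < \<kappa> v)" if "e \<in> E" for e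
    using that less finite_simple_graph_edge_subset[OF graph] by metis
  then show "asc E \<zeta> \<kappa>' = asc E \<zeta> \<kappa>"
    unfolding asc_def by (intro arg_cong[where f = card]) blast
qed

lemma ex_relabel:
  assumes i: "i \<in> weak_seqs n" and i': "i' \<in> weak_seqs n"
    and steps: "strict_steps n i = strict_steps n i'"
  shows "\<exists>\<phi>. \<forall>j\<in>{1..n}. \<phi> (i j) = i' j"
proof (intro exI ballI)
  fix j assume j: "j \<in> {1..n}"
  \<comment> \<open>The chosen position \<open>l\<close> may differ from \<open>j\<close>, but equal
    values of \<open>i\<close> force equal values of \<open>i'\<close>, so the renaming is well
    defined.\<close>
  define l where "l = inv_into {1..n} i (i j)"
  have l: "l \<in> {1..n}" "i l = i j"
    using j unfolding l_def by (metis imageI inv_into_into, metis imageI f_inv_into_f)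
  then have "\<not> i' l < i' j" "\<not> i' j < i' l"
    using weak_seqs_less_iff[OF i] weak_seqs_less_iff[OF i'] j steps by (metis less_irrefl_nat)+
  then show "(\<lambda>x. i' (inv_into {1..n} i x)) (i j) = i' j"
    by (simp add: l_def)
qed

text \<open>Renaming colors from \<open>i\<close> to \<open>i'\<close> and back gives mutually
  inverse bijections between the two sets of colorings, and both preserve the power of t.\<close>

lemma chromatic_qsym_quasisymmetric:
  assumes graph: "finite_simple_graph V E" and n: "card V = n"
    and i: "i \<in> weak_seqs n" and i': "i' \<in> weak_seqs n"
    and steps: "strict_steps n i = strict_steps n i'"
  shows "chromatic_qsym V E \<zeta> (var_prod {1..n} i) = chromatic_qsym V E \<zeta> (var_prod {1..n} i')"
proof -
  obtain \<phi> where \<phi>: "\<And>j. j \<in> {1..n} \<Longrightarrow> \<phi> (i j) = i' j"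
    using ex_relabel[OF i i' steps] by blast
  obtain \<psi> where \<psi>: "\<And>j. j \<in> {1..n} \<Longrightarrow> \<psi> (i' j) = i j"
    using ex_relabel[OF i' i steps[symmetric]] by blast
  have fin: "finite V"
    using graph by (simp add: finite_simple_graph_def)
  have inverse: "(\<lambda>v\<in>V. g ((\<lambda>v\<in>V. f (\<kappa> v)) v)) = \<kappa>"
    if \<kappa>: "\<kappa> \<in> proper_colorings V E" "var_prod V \<kappa> = var_prod {1..n} h"
      and gf: "\<And>j. j \<in> {1..n} \<Longrightarrow> g (f (h j)) = h j" for f g h \<kappa>
  proof (rule extensionalityI)
    show "\<kappa> \<in> extensional V"
      using \<kappa>(1) by (auto simp: proper_colorings_def PiE_iff)
    fix v assume v: "v \<in> V"
    have "\<kappa> ` V = h ` {1..n}"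
      using var_prod_eq_imp_image_eq[OF fin _ \<kappa>(2)] by simp
    then obtain j where "j \<in> {1..n}" "\<kappa> v = h j"
      using v by (metis imageE imageI)
    then show "(\<lambda>v\<in>V. g ((\<lambda>v\<in>V. f (\<kappa> v)) v)) v = \<kappa> v"
      using v gf by simp
  qed simp
  note up = relabel_coloring[OF graph n i i' steps \<phi>]
  note down = relabel_coloring[OF graph n i' i steps[symmetric] \<psi>]
  show ?thesis
    unfolding chromatic_qsym_def formal_sum_def
  proof (rule sum.reindex_bij_witness[where
        i = "\<lambda>\<kappa>. \<lambda>v\<in>V. \<psi> (\<kappa> v)" and j = "\<lambda>\<kappa>. \<lambda>v\<in>V. \<phi> (\<kappa> v)"])
    fix \<kappa> assume "\<kappa> \<in> {\<kappa> \<in> proper_colorings V E. var_prod V \<kappa> = var_prod {1..n} i}"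
    then have \<kappa>: "\<kappa> \<in> proper_colorings V E" "var_prod V \<kappa> = var_prod {1..n} i"
      by blast+
    show "(\<lambda>v\<in>V. \<psi> ((\<lambda>v\<in>V. \<phi> (\<kappa> v)) v)) = \<kappa>"
      using \<phi> \<psi> by (intro inverse[OF \<kappa>]) metis
    show "(\<lambda>v\<in>V. \<phi> (\<kappa> v)) \<in> {\<kappa> \<in> proper_colorings V E. var_prod V \<kappa> = var_prod {1..n} i'}"
      using up(1,2)[OF _ \<kappa>] by blast
    show "monom 1 (asc E \<zeta> (\<lambda>v\<in>V. \<phi> (\<kappa> v))) = (monom 1 (asc E \<zeta> \<kappa>) :: int poly)"
      using up(3)[OF _ \<kappa>] by metis
  next
    fix \<kappa> assume "\<kappa> \<in> {\<kappa> \<in> proper_colorings V E. var_prod V \<kappa> = var_prod {1..n} i'}"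
    then have \<kappa>: "\<kappa> \<in> proper_colorings V E" "var_prod V \<kappa> = var_prod {1..n} i'"
      by blast+
    show "(\<lambda>v\<in>V. \<phi> ((\<lambda>v\<in>V. \<psi> (\<kappa> v)) v)) = \<kappa>"
      using \<phi> \<psi> by (intro inverse[OF \<kappa>]) metis
    show "(\<lambda>v\<in>V. \<psi> (\<kappa> v)) \<in> {\<kappa> \<in> proper_colorings V E. var_prod V \<kappa> = var_prod {1..n} i}"
      using down(1,2)[OF _ \<kappa>] by blast
  qed
qed

lemma chromatic_qsym_eq_0:
  assumes graph: "finite_simple_graph V E" and n: "card V = n"
    and m: "m \<notin> var_prod {1..n} ` weak_seqs n"
  shows "chromatic_qsym V E \<zeta> m = 0"
proof -
  have "var_prod V \<kappa> \<noteq> m" if "\<kappa> \<in> proper_colorings V E" for \<kappa>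
  proof -
    have "\<exists>i\<in>weak_seqs n. var_prod V \<kappa> = var_prod {1..n} i"
      using that graph n
      by (intro ex_weak_seq) (auto simp: proper_colorings_def finite_simple_graph_def PiE_iff)
    then show ?thesis
      using m by auto
  qed
  then have empty: "{\<kappa> \<in> proper_colorings V E. var_prod V \<kappa> = m} = {}"
    by blast
  show ?thesis
    unfolding chromatic_qsym_def formal_sum_def empty by simp
qed

text \<open>By quasisymmetry a weakly increasing sequence may be replaced by the packed one with the
  same strict steps, which leaves one equation for each subset of \<open>{1..n - 1}\<close>.\<close>

lemma fundamental_expansion_chromatic_iff:
  assumes graph: "finite_simple_graph V E" and n: "card V = n"
  shows "fundamental_expansion n (chromatic_qsym V E \<zeta>) d \<longleftrightarrow>
    (\<forall>T\<subseteq>{1..n - 1}. chromatic_qsym V E \<zeta> (var_prod {1..n} (packed_seq n T)) = sum d (Pow T))"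
    (is "?lhs \<longleftrightarrow> ?rhs")
proof
  assume ?lhs
  show ?rhs
  proof (intro allI impI)
    fix T assume "T \<subseteq> {1..n - 1}"
    with \<open>?lhs\<close> show "chromatic_qsym V E \<zeta> (var_prod {1..n} (packed_seq n T)) = sum d (Pow T)"
      using packed_seq_in_weak_seqs strict_steps_packed_seq unfolding fundamental_expansion_iff
      by metis
  qed
next
  assume rhs: ?rhs
  show ?lhs
    unfolding fundamental_expansion_iff
  proof (intro conjI allI impI ballI)
    fix m assume "m \<notin> var_prod {1..n} ` weak_seqs n"
    then show "chromatic_qsym V E \<zeta> m = 0"
      by (rule chromatic_qsym_eq_0[OF graph n])
  next
    fix i assume i: "i \<in> weak_seqs n"
    have "chromatic_qsym V E \<zeta> (var_prod {1..n} i) =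
        chromatic_qsym V E \<zeta> (var_prod {1..n} (packed_seq n (strict_steps n i)))"
      by (intro chromatic_qsym_quasisymmetric[OF graph n i packed_seq_in_weak_seqs]
          strict_steps_packed_seq[symmetric] strict_steps_subset)
    also have "\<dots> = sum d (Pow (strict_steps n i))"
      using rhs strict_steps_subset by blast
    finally show "chromatic_qsym V E \<zeta> (var_prod {1..n} i) = sum d (Pow (strict_steps n i))" .
  qed
qed

section \<open>Moebius inversion over subsets\<close>

lemma mobius_coefficient:
  fixes d f :: "'a set \<Rightarrow> 'b::ring_1"
  assumes "finite U" "\<And>T. T \<subseteq> U \<Longrightarrow> f T = sum d (Pow T)" "S \<subseteq> U"
  shows "d S = (\<Sum>T\<in>Pow S. (-1) ^ (card S - card T) * f T)"
proof -
  \<comment> \<open>Inversion at \<open>S\<close> involves only subsets of \<open>S\<close>, and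
    these lie in \<open>U\<close>, where \<open>f\<close> is known.\<close>
  have "d S = (\<Sum>T\<in>Pow S. (-1) ^ (card S - card T) * sum d (Pow T))"
    using assms(1,3) by (intro inclusion_exclusion_mobius) (auto intro: finite_subset)
  also have "\<dots> = (\<Sum>T\<in>Pow S. (-1) ^ (card S - card T) * f T)"
    using assms(2,3) by (intro sum.cong) auto
  finally show ?thesis .
qed

lemma mobius_exists:
  fixes f :: "'a set \<Rightarrow> 'b::ring_1"
  shows "\<exists>d. \<forall>T. finite T \<longrightarrow> f T = sum d (Pow T)"
proof (intro exI allI impI)
  fix T :: "'a set" assume "finite T"
  \<comment> \<open>The right side supplies the witness: \<open>d S\<close> is the signed sum over
    \<open>R \<subseteq> S\<close>, with the sign split into a factor for \<open>S\<close> and one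
    for \<open>R\<close>.\<close>
  then show "f T = (\<Sum>S\<in>Pow T. (-1) ^ card S * (\<Sum>R\<in>Pow S. (-1) ^ card R * f R))"
    by (rule inclusion_exclusion_symmetric[OF refl])
qed

section \<open>Colorings grouped by orientation\<close>

text \<open>
  \<open>D\<close> may have edges outside \<open>V\<close>: the signed count below removes vertices and keeps \<open>D\<close>.
\<close>

definition decreasing_colorings :: "'a set \<Rightarrow> ('a \<times> 'a) set \<Rightarrow> ('a \<Rightarrow> nat) set" where
  "decreasing_colorings V D =
     {\<kappa> \<in> V \<rightarrow>\<^sub>E {1..}. \<forall>u\<in>V. \<forall>v\<in>V. (u, v) \<in> D \<longrightarrow> \<kappa> v < \<kappa> u}"

definition coloring_orientation :: "'a set set \<Rightarrow> ('a \<Rightarrow> nat) \<Rightarrow> ('a \<times> 'a) set" where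
  "coloring_orientation E \<kappa> = {(u, v). {u, v} \<in> E \<and> \<kappa> v < \<kappa> u}"

lemma decreasing_colorings_subset: "decreasing_colorings V D \<subseteq> V \<rightarrow>\<^sub>E {1..}"
  by (auto simp: decreasing_colorings_def)

lemma acyclic_orientation_subset:
  assumes "finite_simple_graph V E" "D \<in> acyclic_orientations E"
  shows "D \<subseteq> V \<times> V"
  using assms finite_simple_graph_edge_subset[OF assms(1)]
  by (auto simp: acyclic_orientations_def orientation_def)

lemma finite_acyclic_orientations:
  assumes "finite_simple_graph V E"
  shows "finite (acyclic_orientations E)"
proof (rule finite_subset)
  show "acyclic_orientations E \<subseteq> Pow (V \<times> V)"
    using acyclic_orientation_subset[OF assms] by blast
  show "finite (Pow (V \<times> V))"
    using assms by (simp add: finite_simple_graph_def)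
qed

lemma coloring_orientation_acyclic:
  assumes "\<kappa> \<in> proper_colorings V E"
  shows "coloring_orientation E \<kappa> \<in> acyclic_orientations E"
proof -
  have "orientation E (coloring_orientation E \<kappa>)"
    using assms by (auto simp: orientation_def coloring_orientation_def proper_colorings_def
        insert_commute linorder_neq_iff)
  moreover have "acyclic (coloring_orientation E \<kappa>)"
    by (rule acyclicI_order[where f = \<kappa>]) (auto simp: coloring_orientation_def)
  ultimately show ?thesis
    by (simp add: acyclic_orientations_def)
qed

text \<open>An edge of \<open>E\<close> lies in \<open>D\<close> in exactly one direction. Strict
  decrease along \<open>D\<close> therefore already makes the coloring proper and determines its
  orientation.\<close>

lemma coloring_orientation_eq_iff:
  assumes graph: "finite_simple_graph V E" and D: "D \<in> acyclic_orientations E"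
  shows "\<kappa> \<in> proper_colorings V E \<and> coloring_orientation E \<kappa> = D \<longleftrightarrow> \<kappa> \<in> decreasing_colorings V D"
    (is "?lhs \<longleftrightarrow> ?rhs")
proof
  assume ?lhs
  then show ?rhs
    by (auto simp: proper_colorings_def coloring_orientation_def decreasing_colorings_def)
next
  assume \<kappa>: ?rhs
  have edge: "{u, v} \<in> E" if "(u, v) \<in> D" for u v
    using that D by (auto simp: acyclic_orientations_def orientation_def)
  have either: "(u, v) \<in> D \<longleftrightarrow> (v, u) \<notin> D" if "{u, v} \<in> E" for u v
    using that D by (auto simp: acyclic_orientations_def orientation_def)
  have dec: "\<kappa> v < \<kappa> u" if "(u, v) \<in> D" for u v
    using that \<kappa> acyclic_orientation_subset[OF graph D] by (auto simp: decreasing_colorings_def)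
  have "\<kappa> u \<noteq> \<kappa> v" if "{u, v} \<in> E" for u v
    using either[OF that] dec by fastforce
  then have "\<kappa> \<in> proper_colorings V E"
    using \<kappa> by (auto simp: proper_colorings_def decreasing_colorings_def)
  moreover have "(u, v) \<in> coloring_orientation E \<kappa> \<longleftrightarrow> (u, v) \<in> D" for u v
    using edge[of u v] either[of u v] dec[of u v] dec[of v u]
    by (auto simp: coloring_orientation_def)
  ultimately show ?lhs
    by auto
qed

text \<open>Edges point to the smaller color, so an edge along which \<zeta> and \<kappa> increase
  together points from the larger label to the smaller. A pair and its reverse cannot both be such
  edges, so forgetting directions loses nothing.\<close>

lemma asc_eq_des: "asc E \<zeta> \<kappa> = des \<zeta> (coloring_orientation E \<kappa>)"
proof -
  let ?P = "{(u, v) \<in> coloring_orientation E \<kappa>. \<zeta> v < \<zeta> u}"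
  have "inj_on (\<lambda>(u, v). {u, v}) ?P"
    by (auto simp: inj_on_def doubleton_eq_iff)
  then have "card ((\<lambda>(u, v). {u, v}) ` ?P) = card ?P"
    by (rule card_image)
  moreover have "(\<lambda>(u, v). {u, v}) ` ?P =
      {e \<in> E. \<exists>u v. e = {u, v} \<and> \<zeta> u < \<zeta> v \<and> \<kappa> u < \<kappa> v}"
    by (auto simp: coloring_orientation_def image_iff insert_commute)
  ultimately show ?thesis
    unfolding asc_def des_def by (simp only:)
qed

text \<open>The power of t is constant on the colorings inducing a given orientation, by
  \<open>asc_eq_des\<close>.\<close>

lemma chromatic_qsym_by_orientation:
  assumes graph: "finite_simple_graph V E"
  shows "chromatic_qsym V E \<zeta> m =
    (\<Sum>D\<in>acyclic_orientations E.
       of_nat (card {\<kappa> \<in> decreasing_colorings V D. var_prod V \<kappa> = m}) * monom 1 (des \<zeta> D))"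
proof -
  let ?S = "{\<kappa> \<in> proper_colorings V E. var_prod V \<kappa> = m}"
  let ?w = "\<lambda>\<kappa>. monom 1 (asc E \<zeta> \<kappa>) :: int poly"
  have "finite V"
    using graph by (simp add: finite_simple_graph_def)
  have "chromatic_qsym V E \<zeta> m = sum ?w ?S"
    by (simp add: chromatic_qsym_def formal_sum_def)
  also have "\<dots> = (\<Sum>D\<in>acyclic_orientations E. sum ?w {\<kappa> \<in> ?S. coloring_orientation E \<kappa> = D})"
    using finite_acyclic_orientations[OF graph] coloring_orientation_acyclic
      finite_var_prod_fibre[OF \<open>finite V\<close> proper_colorings_subset]
    by (intro sum.group[symmetric]) auto
  also have "\<dots> = (\<Sum>D\<in>acyclic_orientations E.
      of_nat (card {\<kappa> \<in> decreasing_colorings V D. var_prod V \<kappa> = m}) * monom 1 (des \<zeta> D))"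
  proof (rule sum.cong[OF refl])
    fix D assume D: "D \<in> acyclic_orientations E"
    have "{\<kappa> \<in> ?S. coloring_orientation E \<kappa> = D} = {\<kappa> \<in> decreasing_colorings V D. var_prod V \<kappa> = m}"
      using coloring_orientation_eq_iff[OF graph D] by blast
    moreover have "sum ?w {\<kappa> \<in> ?S. coloring_orientation E \<kappa> = D} =
        (\<Sum>\<kappa>\<in>{\<kappa> \<in> ?S. coloring_orientation E \<kappa> = D}. monom 1 (des \<zeta> D))"
      by (intro sum.cong) (auto simp: asc_eq_des)
    ultimately show "sum ?w {\<kappa> \<in> ?S. coloring_orientation E \<kappa> = D} =
        of_nat (card {\<kappa> \<in> decreasing_colorings V D. var_prod V \<kappa> = m}) * monom 1 (des \<zeta> D)"
      by simp
  qed
  finally show ?thesis .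
qed

section \<open>Signed enumeration of packed colorings\<close>

text \<open>Subsets of \<open>insert x F\<close> are split by whether they contain \<open>x\<close>;
  the resulting recursion is Pascal's rule with signs.\<close>

lemma alternating_sum_large_subsets:
  assumes "finite S" "S \<noteq> {}"
  shows "(\<Sum>A\<in>Pow S. if k \<le> card A then (-1) ^ card A else (0::int)) =
    (case k of 0 \<Rightarrow> 0 | Suc j \<Rightarrow> (-1) ^ k * of_nat ((card S - 1) choose j))"
  using assms
proof (induction S arbitrary: k rule: finite_ne_induct)
  case (singleton x)
  then show ?case
    by (auto simp: Pow_insert split: nat.split)
next
  case (insert x F)
  let ?h = "\<lambda>S k. \<Sum>A\<in>Pow S. if k \<le> card A then (-1) ^ card A else (0::int)"
  have inj: "inj_on (insert x) (Pow F)"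
    using insert.hyps by (auto simp: inj_on_def insert_eq_iff)
  have card: "card (insert x A) = Suc (card A)" if "A \<in> Pow F" for A
    using that insert.hyps by (metis PowD card_insert_disjoint finite_subset subsetD)
  have "?h (insert x F) k = ?h F k + (\<Sum>A\<in>insert x ` Pow F. if k \<le> card A then (-1) ^ card A else 0)"
    unfolding Pow_insert using insert.hyps by (intro sum.union_disjoint) auto
  also have "(\<Sum>A\<in>insert x ` Pow F. if k \<le> card A then (-1) ^ card A else (0::int)) =
      (\<Sum>A\<in>Pow F. if k \<le> Suc (card A) then (-1) ^ Suc (card A) else 0)"
    unfolding sum.reindex[OF inj] o_def by (intro sum.cong refl) (simp only: card)
  \<comment> \<open>For \<open>k = 0\<close> truncated subtraction leaves the threshold at 0, and
    both conditions are always true.\<close>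
  also have "\<dots> = - ?h F (k - 1)"
    unfolding sum_negf[symmetric] by (intro sum.cong) auto
  finally have step: "?h (insert x F) k = ?h F k - ?h F (k - 1)"
    by simp
  \<comment> \<open>Writing \<open>card F\<close> as a successor turns both truncated differences
    into ones to which Pascal's rule applies.\<close>
  obtain f where "card F = Suc f"
    using insert.hyps by (metis card_gt_0_iff gr0_implies_Suc)
  then show ?case
    unfolding step insert.IH using insert.hyps
    by (auto simp: algebra_simps split: nat.split)
qed

text \<open>The case \<open>l = 0\<close> admits the empty coloring when \<open>V\<close> is empty,
  where the signed count starts.\<close>

definition packed_colorings :: "'a set \<Rightarrow> ('a \<times> 'a) set \<Rightarrow> ('a \<Rightarrow> nat) set" where
  "packed_colorings V D = {\<kappa> \<in> decreasing_colorings V D. \<exists>l. \<kappa> ` V = {1..l}}"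

text \<open>Sinks are taken relative to \<open>V\<close>, because blocks of vertices are removed
  while \<open>D\<close> stays fixed.\<close>

definition sinks_in :: "'a set \<Rightarrow> ('a \<times> 'a) set \<Rightarrow> 'a set" where
  "sinks_in V D = {v \<in> V. \<forall>w\<in>V. (v, w) \<notin> D}"

definition add_first_block :: "'a set \<Rightarrow> 'a set \<Rightarrow> ('a \<Rightarrow> nat) \<Rightarrow> 'a \<Rightarrow> nat" where
  "add_first_block V A \<kappa> = (\<lambda>v\<in>V. if v \<in> A then 1 else Suc (\<kappa> v))"

lemma sinks_in_subset: "sinks_in V D \<subseteq> V"
  by (auto simp: sinks_in_def)

lemma finite_packed_colorings:
  assumes "finite V"
  shows "finite (packed_colorings V D)"
proof (rule finite_subset)
  show "packed_colorings V D \<subseteq> V \<rightarrow>\<^sub>E {1..card V}"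
  proof
    fix \<kappa> assume \<kappa>: "\<kappa> \<in> packed_colorings V D"
    then obtain l where l: "\<kappa> ` V = {1..l}"
      by (auto simp: packed_colorings_def)
    then have "l \<le> card V"
      using card_image_le[OF assms, of \<kappa>] by simp
    then have "\<kappa> v \<in> {1..card V}" if "v \<in> V" for v
      using that l by (metis atLeastAtMost_iff imageI order_trans)
    then show "\<kappa> \<in> V \<rightarrow>\<^sub>E {1..card V}"
      using \<kappa> by (simp add: packed_colorings_def decreasing_colorings_def PiE_iff)
  qed
  show "finite (V \<rightarrow>\<^sub>E {1..card V})"
    using assms by (simp add: finite_PiE)
qed

text \<open>No edge of \<open>D\<close> leads from \<open>A\<close> into \<open>V\<close>, so
  \<open>A\<close> can receive the lowest color once all others are raised by one. Nonemptiness of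
  \<open>A\<close> keeps the colors gap-free. The second and fourth conclusions recover
  \<open>A\<close> and \<kappa>.\<close>

lemma add_first_block:
  assumes A: "A \<subseteq> sinks_in V D" "A \<noteq> {}" and \<kappa>: "\<kappa> \<in> packed_colorings (V - A) D"
  shows "add_first_block V A \<kappa> \<in> packed_colorings V D"
    and "{v \<in> V. add_first_block V A \<kappa> v = 1} = A"
    and "add_first_block V A \<kappa> ` V = insert 1 (Suc ` \<kappa> ` (V - A))"
    and "(\<lambda>v\<in>V - A. add_first_block V A \<kappa> v - 1) = \<kappa>"
proof -
  have AV: "A \<subseteq> V"
    using A sinks_in_subset[of V D] by blast
  have \<kappa>1: "\<kappa> v \<ge> 1" if "v \<in> V - A" for v
    using that \<kappa> by (auto simp: packed_colorings_def decreasing_colorings_def)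
  obtain l where l: "\<kappa> ` (V - A) = {1..l}"
    using \<kappa> by (auto simp: packed_colorings_def)
  show image: "add_first_block V A \<kappa> ` V = insert 1 (Suc ` \<kappa> ` (V - A))"
    using A AV by (auto simp: add_first_block_def image_iff)
  have "Suc ` {1..l} = {2..Suc l}"
    by (simp add: image_Suc_atLeastAtMost numeral_2_eq_2)
  then have "add_first_block V A \<kappa> ` V = {1..Suc l}"
    unfolding image l by auto
  moreover have "add_first_block V A \<kappa> \<in> V \<rightarrow>\<^sub>E {1..}"
    by (auto simp: add_first_block_def)
  moreover have "add_first_block V A \<kappa> v < add_first_block V A \<kappa> u"
    if "u \<in> V" "v \<in> V" "(u, v) \<in> D" for u v
  proof -
    have "u \<notin> A"
      using that A by (auto simp: sinks_in_def)
    moreover have "\<kappa> v < \<kappa> u" if "v \<notin> A"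
      using that \<kappa> \<open>u \<in> V\<close> \<open>v \<in> V\<close> \<open>(u, v) \<in> D\<close> \<open>u \<notin> A\<close>
      by (simp add: packed_colorings_def decreasing_colorings_def)
    ultimately show ?thesis
      using \<kappa>1[of u] that by (auto simp: add_first_block_def)
  qed
  ultimately show "add_first_block V A \<kappa> \<in> packed_colorings V D"
    by (auto simp: packed_colorings_def decreasing_colorings_def)
  have "add_first_block V A \<kappa> v = 1 \<longleftrightarrow> v \<in> A" if "v \<in> V" for v
    using that \<kappa>1[of v] by (auto simp: add_first_block_def)
  then show "{v \<in> V. add_first_block V A \<kappa> v = 1} = A"
    using AV by blast
  show "(\<lambda>v\<in>V - A. add_first_block V A \<kappa> v - 1) = \<kappa>"
    using \<kappa> by (intro extensionalityI[of _ "V - A"])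
      (auto simp: add_first_block_def packed_colorings_def decreasing_colorings_def PiE_iff)
qed

text \<open>This inverts \<open>add_first_block\<close>. A vertex of color 1 is a sink because its
  out-neighbors in \<open>V\<close> would need a smaller positive color.\<close>

lemma remove_first_block:
  assumes \<kappa>: "\<kappa> \<in> packed_colorings V D" and "V \<noteq> {}"
  defines "A \<equiv> {v \<in> V. \<kappa> v = 1}" and "\<kappa>' \<equiv> \<lambda>v\<in>V - {v \<in> V. \<kappa> v = 1}. \<kappa> v - 1"
  shows "A \<subseteq> sinks_in V D" "A \<noteq> {}" "\<kappa>' \<in> packed_colorings (V - A) D"
    and "add_first_block V A \<kappa>' = \<kappa>"
proof -
  obtain l where l: "\<kappa> ` V = {1..l}"
    using \<kappa> by (auto simp: packed_colorings_def)
  have \<kappa>1: "\<kappa> v \<ge> 1" if "v \<in> V" for v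
    using that \<kappa> by (auto simp: packed_colorings_def decreasing_colorings_def)
  have dec: "\<kappa> v < \<kappa> u" if "u \<in> V" "v \<in> V" "(u, v) \<in> D" for u v
    using that \<kappa> by (auto simp: packed_colorings_def decreasing_colorings_def)
  have \<kappa>2: "\<kappa> v \<ge> 2" if "v \<in> V - A" for v
    using that \<kappa>1[of v] by (auto simp: A_def)
  have "1 \<in> \<kappa> ` V"
    using l \<open>V \<noteq> {}\<close> by (cases l) auto
  then show "A \<noteq> {}"
    by (auto simp: A_def)
  show "A \<subseteq> sinks_in V D"
    using dec \<kappa>1 by (fastforce simp: A_def sinks_in_def)
  have \<kappa>'_eq: "\<kappa>' = (\<lambda>v\<in>V - A. \<kappa> v - 1)"
    by (simp add: \<kappa>'_def A_def)
  have "\<kappa> ` (V - A) = {2..l}"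
  proof -
    have "\<kappa> ` (V - A) = \<kappa> ` V - {1}"
      by (auto simp: A_def)
    then show ?thesis
      unfolding l by auto
  qed
  moreover have "\<kappa>' ` (V - A) = (\<lambda>x. x - 1) ` \<kappa> ` (V - A)"
    by (auto simp: \<kappa>'_eq image_image)
  moreover have "(\<lambda>x. x - 1) ` {2..l} = {1..l - 1}"
    by (force simp: image_iff intro: bexI[of _ "Suc _"])
  ultimately have "\<kappa>' ` (V - A) = {1..l - 1}"
    by simp
  moreover have "1 \<le> \<kappa> v - 1" if "v \<in> V - A" for v
    using \<kappa>2[OF that] by simp
  then have "\<kappa>' \<in> V - A \<rightarrow>\<^sub>E {1..}"
    by (simp add: \<kappa>'_eq PiE_iff)
  moreover have "\<kappa>' v < \<kappa>' u" if "u \<in> V - A" "v \<in> V - A" "(u, v) \<in> D" for u v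
    using that dec[of u v] \<kappa>2[of u] \<kappa>2[of v] by (simp add: \<kappa>'_eq diff_less_mono)
  ultimately show "\<kappa>' \<in> packed_colorings (V - A) D"
    by (auto simp: packed_colorings_def decreasing_colorings_def)
  show "add_first_block V A \<kappa>' = \<kappa>"
  proof (rule extensionalityI)
    show "\<kappa> \<in> extensional V"
      using \<kappa> by (auto simp: packed_colorings_def decreasing_colorings_def PiE_iff)
    fix v assume "v \<in> V"
    then show "add_first_block V A \<kappa>' v = \<kappa> v"
      using \<kappa>2[of v] by (auto simp: add_first_block_def \<kappa>'_eq A_def)
  qed (simp add: add_first_block_def)
qed

text \<open>A packed coloring amounts to its first block \<open>A\<close> together with a packed
  coloring of the rest. Removing the block removes one color, hence the minus sign. The predicate
  \<open>P\<close> lets the same bijection serve with and without a bound on the first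
  block.\<close>

lemma signed_packed_colorings_step:
  assumes "finite V" "V \<noteq> {}"
  shows "(\<Sum>\<kappa> | \<kappa> \<in> packed_colorings V D \<and> P {v \<in> V. \<kappa> v = 1}. (-1) ^ card (\<kappa> ` V)) =
    (\<Sum>A | A \<subseteq> sinks_in V D \<and> A \<noteq> {} \<and> P A.
       - (\<Sum>\<kappa>\<in>packed_colorings (V - A) D. (-1) ^ card (\<kappa> ` (V - A)) :: int))"
proof -
  let ?Q = "{A. A \<subseteq> sinks_in V D \<and> A \<noteq> {} \<and> P A}"
  have fin: "finite ?Q"
    using assms(1) sinks_in_subset[of V D]
    by (intro finite_subset[of ?Q "Pow V"]) auto
  have "(\<Sum>A\<in>?Q. - (\<Sum>\<kappa>\<in>packed_colorings (V - A) D. (-1) ^ card (\<kappa> ` (V - A)) :: int)) =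
      (\<Sum>(A, \<kappa>)\<in>(SIGMA A:?Q. packed_colorings (V - A) D). - ((-1) ^ card (\<kappa> ` (V - A))))"
    unfolding sum_negf[symmetric]
    using assms(1) fin by (intro sum.Sigma) (auto intro: finite_packed_colorings)
  also have "\<dots> = (\<Sum>\<kappa> | \<kappa> \<in> packed_colorings V D \<and> P {v \<in> V. \<kappa> v = 1}. (-1) ^ card (\<kappa> ` V))"
  proof (rule sum.reindex_bij_witness[where j = "\<lambda>(A, \<kappa>). add_first_block V A \<kappa>" and
        i = "\<lambda>\<kappa>. ({v \<in> V. \<kappa> v = 1}, \<lambda>v\<in>V - {v \<in> V. \<kappa> v = 1}. \<kappa> v - 1)"])
    fix a assume "a \<in> (SIGMA A:?Q. packed_colorings (V - A) D)"
    then obtain A \<kappa> where a: "a = (A, \<kappa>)" and A: "A \<subseteq> sinks_in V D" "A \<noteq> {}" "P A"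
      and \<kappa>: "\<kappa> \<in> packed_colorings (V - A) D"
      by auto
    note * = add_first_block[OF A(1,2) \<kappa>]
    show "({v \<in> V. (case a of (A, \<kappa>) \<Rightarrow> add_first_block V A \<kappa>) v = 1},
        \<lambda>v\<in>V - {v \<in> V. (case a of (A, \<kappa>) \<Rightarrow> add_first_block V A \<kappa>) v = 1}.
          (case a of (A, \<kappa>) \<Rightarrow> add_first_block V A \<kappa>) v - 1) = a"
      unfolding a prod.case *(2) *(4) ..
    show "(case a of (A, \<kappa>) \<Rightarrow> add_first_block V A \<kappa>) \<in>
        {\<kappa> \<in> packed_colorings V D. P {v \<in> V. \<kappa> v = 1}}"
      unfolding a prod.case mem_Collect_eq *(2) using *(1) A(3) ..
    \<comment> \<open>Color 1 is new after the shift, so the number of colors grows by exactly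
      one.\<close>
    have "1 \<notin> Suc ` \<kappa> ` (V - A)"
      using \<kappa> by (fastforce simp: packed_colorings_def decreasing_colorings_def PiE_iff)
    then have "card (add_first_block V A \<kappa> ` V) = Suc (card (\<kappa> ` (V - A)))"
      using assms(1) unfolding *(3) by (simp add: card_image)
    then show "(-1) ^ card ((case a of (A, \<kappa>) \<Rightarrow> add_first_block V A \<kappa>) ` V) =
        (case a of (A, \<kappa>) \<Rightarrow> - ((-1 :: int) ^ card (\<kappa> ` (V - A))))"
      by (simp add: a)
  next
    fix \<kappa> assume "\<kappa> \<in> {\<kappa> \<in> packed_colorings V D. P {v \<in> V. \<kappa> v = 1}}"
    then have \<kappa>: "\<kappa> \<in> packed_colorings V D" and P: "P {v \<in> V. \<kappa> v = 1}"
      by blast+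
    note * = remove_first_block[OF \<kappa> assms(2)]
    show "(case ({v \<in> V. \<kappa> v = 1}, \<lambda>v\<in>V - {v \<in> V. \<kappa> v = 1}. \<kappa> v - 1) of
        (A, \<kappa>) \<Rightarrow> add_first_block V A \<kappa>) = \<kappa>"
      unfolding prod.case by (rule *(4))
    show "({v \<in> V. \<kappa> v = 1}, \<lambda>v\<in>V - {v \<in> V. \<kappa> v = 1}. \<kappa> v - 1) \<in>
        (SIGMA A:?Q. packed_colorings (V - A) D)"
      using *(1,2,3) P by blast
  qed
  finally show ?thesis ..
qed

text \<open>The converse of a finite acyclic relation is well-founded, and a minimal vertex for it
  is a sink.\<close>

lemma sinks_in_nonempty:
  assumes "finite V" "V \<noteq> {}" "acyclic D"
  shows "sinks_in V D \<noteq> {}"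
proof -
  let ?R = "D \<inter> V \<times> V"
  have "wf (?R\<inverse>)"
    using assms by (intro finite_acyclic_wf_converse acyclic_subset[OF assms(3)]) auto
  then obtain v where "v \<in> V" "\<And>w. (w, v) \<in> ?R\<inverse> \<Longrightarrow> w \<notin> V"
    using assms(2) by (meson wfE_min ex_in_conv)
  then have "v \<in> sinks_in V D"
    unfolding sinks_in_def by blast
  then show ?thesis
    by blast
qed

text \<open>The sign of \<open>card (V - A)\<close> factors into those of \<open>card V\<close> and
  \<open>card A\<close>; the rest is the alternating sum over the nonempty set of sinks with
  threshold \<open>Suc j\<close>.\<close>

lemma alternating_sum_sinks:
  assumes "finite V" "V \<noteq> {}" "acyclic D"
  shows "(\<Sum>A | A \<subseteq> sinks_in V D \<and> A \<noteq> {} \<and> Suc j \<le> card A. - ((-1) ^ card (V - A))) =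
    ((-1) ^ (card V + j) * of_nat ((card (sinks_in V D) - 1) choose j) :: int)"
proof -
  have fin: "finite (sinks_in V D)"
    using assms(1) sinks_in_subset[of V D] finite_subset by blast
  have sgn: "- ((-1) ^ card (V - A)) = - ((-1) ^ card V) * ((-1) ^ card A :: int)"
    if "A \<subseteq> sinks_in V D" for A
  proof -
    have "A \<subseteq> V"
      using that sinks_in_subset[of V D] by blast
    then show ?thesis
      using assms(1) finite_subset[of A V] card_mono[of V A]
      by (simp add: card_Diff_subset neg_one_power_add_eq_neg_one_power_diff flip: power_add)
  qed
  have set_eq: "{A. A \<subseteq> sinks_in V D \<and> A \<noteq> {} \<and> Suc j \<le> card A} =
      {A \<in> Pow (sinks_in V D). Suc j \<le> card A}"
    by auto
  have "(\<Sum>A | A \<subseteq> sinks_in V D \<and> A \<noteq> {} \<and> Suc j \<le> card A. - ((-1) ^ card (V - A))) =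
      - ((-1) ^ card V) * (\<Sum>A | A \<in> Pow (sinks_in V D) \<and> Suc j \<le> card A. (-1) ^ card A :: int)"
    unfolding set_eq sum_distrib_left using sgn by (intro sum.cong) auto
  also have "(\<Sum>A | A \<in> Pow (sinks_in V D) \<and> Suc j \<le> card A. (-1) ^ card A :: int) =
      (\<Sum>A\<in>Pow (sinks_in V D). if Suc j \<le> card A then (-1) ^ card A else 0)"
    using fin by (intro sum.inter_filter) simp
  also have "\<dots> = (-1) ^ Suc j * of_nat ((card (sinks_in V D) - 1) choose j)"
    using alternating_sum_large_subsets[OF fin sinks_in_nonempty[OF assms], of "Suc j"] by simp
  finally show ?thesis
    by (simp add: power_add mult.assoc)
qed

text \<open>This is the value at -1 of the strict order polynomial of the poset generated by the
  edges of \<open>D\<close> inside \<open>V\<close>. The induction peels off the first block and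
  applies the hypothesis to what remains.\<close>

lemma signed_packed_colorings:
  assumes "finite V" "acyclic D"
  shows "(\<Sum>\<kappa>\<in>packed_colorings V D. (-1) ^ card (\<kappa> ` V)) = ((-1) ^ card V :: int)"
  using assms(1)
proof (induction V rule: finite_psubset_induct)
  case (psubset V)
  show ?case
  proof (cases "V = {}")
    case True
    then have "packed_colorings V D = {\<lambda>_. undefined}"
      by (auto simp: packed_colorings_def decreasing_colorings_def)
    then show ?thesis
      using True by simp
  next
    case False
    have "(\<Sum>\<kappa>\<in>packed_colorings V D. (-1) ^ card (\<kappa> ` V)) =
        (\<Sum>A | A \<subseteq> sinks_in V D \<and> A \<noteq> {} \<and> True.
          - (\<Sum>\<kappa>\<in>packed_colorings (V - A) D. (-1) ^ card (\<kappa> ` (V - A)) :: int))"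
      using signed_packed_colorings_step[OF psubset.hyps False, of D "\<lambda>_. True"] by simp
    also have "\<dots> = (\<Sum>A | A \<subseteq> sinks_in V D \<and> A \<noteq> {} \<and> True. - ((-1) ^ card (V - A)))"
    proof (rule sum.cong[OF refl])
      fix A assume "A \<in> {A. A \<subseteq> sinks_in V D \<and> A \<noteq> {} \<and> True}"
      then have "V - A \<subset> V"
        using sinks_in_subset[of V D] by blast
      then show "- (\<Sum>\<kappa>\<in>packed_colorings (V - A) D. (-1) ^ card (\<kappa> ` (V - A)) :: int) =
          - ((-1) ^ card (V - A))"
        using psubset.IH by simp
    qed
    \<comment> \<open>Nonempty means of size at least 1, which is the case \<open>j = 0\<close> of
      \<open>alternating_sum_sinks\<close>.\<close>
    also have "\<dots> = (\<Sum>A | A \<subseteq> sinks_in V D \<and> A \<noteq> {} \<and> Suc 0 \<le> card A. - ((-1) ^ card (V - A)))"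
      using psubset.hyps sinks_in_subset[of V D]
      by (intro sum.cong refl Collect_cong) (auto simp: Suc_le_eq card_gt_0_iff intro: finite_subset)
    also have "\<dots> = (-1) ^ card V"
      using alternating_sum_sinks[OF psubset.hyps False assms(2), of 0] by simp
    finally show ?thesis .
  qed
qed

text \<open>Only the first block is constrained; the remaining vertices contribute their full signed
  count.\<close>

lemma signed_packed_colorings_large_first_block:
  assumes "finite V" "V \<noteq> {}" "acyclic D"
  shows "(\<Sum>\<kappa> | \<kappa> \<in> packed_colorings V D \<and> Suc j \<le> card {v \<in> V. \<kappa> v = 1}. (-1) ^ card (\<kappa> ` V)) =
    ((-1) ^ (card V + j) * of_nat ((card (sinks_in V D) - 1) choose j) :: int)"
proof -
  have "(\<Sum>\<kappa> | \<kappa> \<in> packed_colorings V D \<and> Suc j \<le> card {v \<in> V. \<kappa> v = 1}. (-1) ^ card (\<kappa> ` V)) =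
      (\<Sum>A | A \<subseteq> sinks_in V D \<and> A \<noteq> {} \<and> Suc j \<le> card A. - ((-1) ^ card (V - A)) :: int)"
    using signed_packed_colorings_step[OF assms(1,2), of D "\<lambda>A. Suc j \<le> card A"] assms
    by (simp add: signed_packed_colorings)
  then show ?thesis
    by (simp add: alternating_sum_sinks[OF assms])
qed

section \<open>The hook coefficients\<close>

text \<open>Sorting the colors of a packed coloring yields a packed sequence, whose strict steps lie
  in \<open>{k..n - 1}\<close> exactly when color 1 occurs at least \<open>k\<close> times.\<close>

lemma packed_colorings_by_composition:
  assumes "finite V" "card V = n" "1 \<le> k" "k \<le> n"
  shows "{\<kappa> \<in> packed_colorings V D. k \<le> card {v \<in> V. \<kappa> v = 1}} =
    (\<Union>T\<in>Pow {k..n - 1}. {\<kappa> \<in> decreasing_colorings V D. var_prod V \<kappa> = var_prod {1..n} (packed_seq n T)})"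
    (is "?L = ?R")
proof
  have sub: "T \<subseteq> {1..n - 1}" if "T \<subseteq> {k..n - 1}" for T
    using that assms(3) by force
  show "?R \<subseteq> ?L"
  proof
    fix \<kappa> assume "\<kappa> \<in> ?R"
    then obtain T where T: "T \<subseteq> {k..n - 1}" and \<kappa>: "\<kappa> \<in> decreasing_colorings V D"
      and eq: "var_prod V \<kappa> = var_prod {1..n} (packed_seq n T)"
      by blast
    have "\<kappa> ` V = {1..Suc (card T)}"
      using var_prod_eq_imp_image_eq[OF assms(1) _ eq] packed_seq_image[OF sub[OF T]] assms by simp
    then have "\<kappa> \<in> packed_colorings V D"
      using \<kappa> unfolding packed_colorings_def by blast
    moreover have "k \<le> card {v \<in> V. \<kappa> v = 1}"
      using packed_seq_first_block[OF sub[OF T] assms(3,4)] T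
        var_prod_eq_imp_card_fibre_eq[OF assms(1) _ eq, of 1] by simp
    ultimately show "\<kappa> \<in> ?L"
      by blast
  qed
  show "?L \<subseteq> ?R"
  proof
    fix \<kappa> assume "\<kappa> \<in> ?L"
    then have \<kappa>: "\<kappa> \<in> packed_colorings V D" and k: "k \<le> card {v \<in> V. \<kappa> v = 1}"
      by blast+
    obtain l where l: "\<kappa> ` V = {1..l}"
      using \<kappa> by (auto simp: packed_colorings_def)
    have dec: "\<kappa> \<in> decreasing_colorings V D"
      using \<kappa> by (simp add: packed_colorings_def)
    have "\<exists>i\<in>weak_seqs n. var_prod V \<kappa> = var_prod {1..n} i"
      using dec assms(1,2) by (intro ex_weak_seq) (auto simp: decreasing_colorings_def)
    then obtain i where i: "i \<in> weak_seqs n" and eq: "var_prod V \<kappa> = var_prod {1..n} i"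
      by blast
    have "i ` {1..n} = {1..l}"
      using var_prod_eq_imp_image_eq[OF assms(1) _ eq] l by simp
    then have i_eq: "i = packed_seq n (strict_steps n i)"
      by (rule packed_seq_eqI[OF i])
    have "k \<le> card {j \<in> {1..n}. i j = 1}"
      using k var_prod_eq_imp_card_fibre_eq[OF assms(1) _ eq, of 1] by simp
    then have "strict_steps n i \<subseteq> {k..n - 1}"
      using packed_seq_first_block[OF strict_steps_subset assms(3,4), of i] i_eq by metis
    then show "\<kappa> \<in> ?R"
      using dec eq i_eq by (metis (mono_tags, lifting) PowI UN_iff mem_Collect_eq)
  qed
qed

lemma signed_hook_count:
  assumes "finite V" "card V = n" "1 \<le> k" "k \<le> n" "acyclic D"
  shows "(\<Sum>T\<in>Pow {k..n - 1}. (-1) ^ (card {k..n - 1} - card T) *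
      of_nat (card {\<kappa> \<in> decreasing_colorings V D. var_prod V \<kappa> = var_prod {1..n} (packed_seq n T)})) =
    (of_nat ((card (sinks_in V D) - 1) choose (k - 1)) :: int)"
proof -
  let ?N = "\<lambda>T. {\<kappa> \<in> decreasing_colorings V D. var_prod V \<kappa> = var_prod {1..n} (packed_seq n T)}"
  have V: "V \<noteq> {}"
    using assms by auto
  have sub: "T \<subseteq> {1..n - 1}" if "T \<in> Pow {k..n - 1}" for T
    using that assms(3) by force
  \<comment> \<open>Colorings with this monomial use \<open>Suc (card T)\<close> colors, so up to a
    global sign the Moebius sign is the parity of the number of colors.\<close>
  have sgn: "(-1) ^ (card {k..n - 1} - card T) * of_nat (card (?N T)) =
      (-1) ^ (n + (k - 1)) * (\<Sum>\<kappa>\<in>?N T. (-1) ^ card (\<kappa> ` V) :: int)"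
    if T: "T \<in> Pow {k..n - 1}" for T
  proof -
    have "\<kappa> ` V = {1..Suc (card T)}" if "\<kappa> \<in> ?N T" for \<kappa>
      using that var_prod_eq_imp_image_eq[OF assms(1), of "{1..n}" \<kappa> "packed_seq n T"]
        packed_seq_image[OF sub[OF T]] assms by simp
    then have "(\<Sum>\<kappa>\<in>?N T. (-1) ^ card (\<kappa> ` V) :: int) = (\<Sum>\<kappa>\<in>?N T. (-1) ^ Suc (card T))"
      by (intro sum.cong) auto
    moreover have "card T \<le> n - k"
      using card_mono[of "{k..n - 1}" T] T assms by auto
    then have "(-1 :: int) ^ (card {k..n - 1} - card T) = (-1) ^ (n + (k - 1)) * (-1) ^ Suc (card T)"
      using assms(3,4) by (auto simp: minus_one_power_iff)
    ultimately show ?thesis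
      by simp
  qed
  \<comment> \<open>Different \<open>T\<close> give different packed sequences, hence different
    monomials.\<close>
  have disj: "?N T \<inter> ?N T' = {}"
    if T: "T \<in> Pow {k..n - 1}" "T' \<in> Pow {k..n - 1}" "T \<noteq> T'" for T T'
  proof -
    have "packed_seq n T \<noteq> packed_seq n T'"
      using strict_steps_packed_seq[OF sub[OF T(1)]] strict_steps_packed_seq[OF sub[OF T(2)]] T(3)
      by metis
    then have "var_prod {1..n} (packed_seq n T) \<noteq> var_prod {1..n} (packed_seq n T')"
      using weak_seqs_eqI[OF packed_seq_in_weak_seqs packed_seq_in_weak_seqs] by blast
    then show ?thesis
      by auto
  qed
  have "(\<Sum>T\<in>Pow {k..n - 1}. (-1) ^ (card {k..n - 1} - card T) * of_nat (card (?N T))) =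
      (-1) ^ (n + (k - 1)) * (\<Sum>T\<in>Pow {k..n - 1}. \<Sum>\<kappa>\<in>?N T. (-1) ^ card (\<kappa> ` V) :: int)"
    unfolding sum_distrib_left[of _ _ "Pow _"] using sgn by (intro sum.cong refl)
  also have "(\<Sum>T\<in>Pow {k..n - 1}. \<Sum>\<kappa>\<in>?N T. (-1) ^ card (\<kappa> ` V) :: int) =
      (\<Sum>\<kappa>\<in>(\<Union>T\<in>Pow {k..n - 1}. ?N T). (-1) ^ card (\<kappa> ` V))"
    using disj finite_var_prod_fibre[OF assms(1) decreasing_colorings_subset]
    by (intro sum.UNION_disjoint[symmetric]) auto
  also have "\<dots> = (\<Sum>\<kappa> | \<kappa> \<in> packed_colorings V D \<and> Suc (k - 1) \<le> card {v \<in> V. \<kappa> v = 1}.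
      (-1) ^ card (\<kappa> ` V))"
    using packed_colorings_by_composition[OF assms(1-4), of D] assms(3) by simp
  also have "\<dots> = (-1) ^ (n + (k - 1)) * of_nat ((card (sinks_in V D) - 1) choose (k - 1))"
    using signed_packed_colorings_large_first_block[OF assms(1) V assms(5), of "k - 1"] assms(2)
    by simp
  \<comment> \<open>The global sign now occurs twice and cancels.\<close>
  finally show ?thesis
    by (simp flip: mult.assoc power_add)
qed

text \<open>Moebius inversion at the hook set is combined with the decomposition by orientation.
  After the sums are exchanged, the inner one is the integer of
  \<open>signed_hook_count\<close>.\<close>

lemma hook_coefficient:
  assumes graph: "finite_simple_graph V E" and n: "card V = n"
    and expansion: "fundamental_expansion n (chromatic_qsym V E \<zeta>) d"
    and k: "1 \<le> k" "k \<le> n"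
  shows "d {k..n - 1} =
    (\<Sum>D\<in>acyclic_orientations E. of_nat ((snk V D - 1) choose (k - 1)) * monom 1 (des \<zeta> D))"
proof -
  let ?s = "\<lambda>T. (-1) ^ (card {k..n - 1} - card T)"
  let ?N = "\<lambda>T D. card {\<kappa> \<in> decreasing_colorings V D. var_prod V \<kappa> = var_prod {1..n} (packed_seq n T)}"
  have "finite V"
    using graph by (simp add: finite_simple_graph_def)
  have "d {k..n - 1} = (\<Sum>T\<in>Pow {k..n - 1}. ?s T *
      chromatic_qsym V E \<zeta> (var_prod {1..n} (packed_seq n T)))"
    using expansion k unfolding fundamental_expansion_chromatic_iff[OF graph n]
    by (intro mobius_coefficient[of "{1..n - 1}"]) auto
  also have "\<dots> = (\<Sum>D\<in>acyclic_orientations E. \<Sum>T\<in>Pow {k..n - 1}.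
      ?s T * (of_nat (?N T D) * monom 1 (des \<zeta> D)))"
    unfolding chromatic_qsym_by_orientation[OF graph] sum_distrib_left by (rule sum.swap)
  also have "\<dots> = (\<Sum>D\<in>acyclic_orientations E.
      of_int (\<Sum>T\<in>Pow {k..n - 1}. ?s T * of_nat (?N T D)) * monom 1 (des \<zeta> D))"
    by (simp add: sum_distrib_right mult.assoc)
  also have "\<dots> = (\<Sum>D\<in>acyclic_orientations E.
      of_nat ((snk V D - 1) choose (k - 1)) * monom 1 (des \<zeta> D))"
  proof (rule sum.cong[OF refl])
    fix D assume D: "D \<in> acyclic_orientations E"
    have "acyclic D"
      using D by (simp add: acyclic_orientations_def)
    \<comment> \<open>All edges of \<open>D\<close> stay inside \<open>V\<close>, so the relative
      sinks are the actual ones.\<close>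
    moreover have "sinks_in V D = {v \<in> V. \<forall>w. (v, w) \<notin> D}"
      using acyclic_orientation_subset[OF graph D] by (auto simp: sinks_in_def)
    ultimately show "of_int (\<Sum>T\<in>Pow {k..n - 1}. ?s T * of_nat (?N T D)) * monom 1 (des \<zeta> D) =
        of_nat ((snk V D - 1) choose (k - 1)) * (monom 1 (des \<zeta> D) :: int poly)"
      using signed_hook_count[OF \<open>finite V\<close> n k, of D] by (simp only: snk_def of_int_of_nat_eq)
  qed
  finally show ?thesis .
qed

theorem theorem2:
  fixes V :: "'a set" and E :: "'a set set" and \<zeta> :: "'a \<Rightarrow> nat" and n :: nat
  assumes "finite_simple_graph V E"
    and "card V = n"
    and "bij_betw \<zeta> V {1..n}"
  shows "(\<exists>!d. d \<in> Pow {1..n - 1} \<rightarrow>\<^sub>E UNIV \<and>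
            fundamental_expansion n (chromatic_qsym V E \<zeta>) d) \<and>
         (\<forall>d. fundamental_expansion n (chromatic_qsym V E \<zeta>) d \<longrightarrow>
            (\<forall>k. 1 \<le> k \<and> k \<le> n \<longrightarrow>
              d {k..n - 1} =
                (\<Sum>D\<in>acyclic_orientations E.
                   of_nat ((snk V D - 1) choose (k - 1)) * monom 1 (des \<zeta> D))))"
proof (intro conjI)
  let ?X = "chromatic_qsym V E \<zeta>"
  let ?f = "\<lambda>T. ?X (var_prod {1..n} (packed_seq n T))"
  note iff = fundamental_expansion_chromatic_iff[OF assms(1,2), of \<zeta>]
  \<comment> \<open>A solution on all finite sets is taken first; restricting it to
    \<open>Pow {1..n - 1}\<close> gives the extensional coefficient family.\<close>
  obtain d where d: "\<And>T. finite T \<Longrightarrow> ?f T = sum d (Pow T)"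
    using mobius_exists[of ?f] by blast
  show "\<exists>!d. d \<in> Pow {1..n - 1} \<rightarrow>\<^sub>E UNIV \<and> fundamental_expansion n ?X d"
  proof (rule ex1I)
    have "?f T = sum (restrict d (Pow {1..n - 1})) (Pow T)" if "T \<subseteq> {1..n - 1}" for T
    proof -
      have "sum (restrict d (Pow {1..n - 1})) (Pow T) = sum d (Pow T)"
        using that by (intro sum.cong) auto
      then show ?thesis
        using d[of T] that finite_subset by fastforce
    qed
    then show "restrict d (Pow {1..n - 1}) \<in> Pow {1..n - 1} \<rightarrow>\<^sub>E UNIV \<and>
        fundamental_expansion n ?X (restrict d (Pow {1..n - 1}))"
      unfolding iff by simp
  next
    fix e assume e: "e \<in> Pow {1..n - 1} \<rightarrow>\<^sub>E UNIV \<and> fundamental_expansion n ?X e"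
    show "e = restrict d (Pow {1..n - 1})"
    proof (rule extensionalityI)
      show "e \<in> extensional (Pow {1..n - 1})"
        using e by (simp add: PiE_def)
      fix S assume "S \<in> Pow {1..n - 1}"
      then have S: "S \<subseteq> {1..n - 1}"
        by simp
      \<comment> \<open>Both families are recovered from \<open>?f\<close> by the same inversion
        formula, so they agree.\<close>
      have "e S = (\<Sum>T\<in>Pow S. (-1) ^ (card S - card T) * ?f T)"
        using e S unfolding iff by (intro mobius_coefficient[of "{1..n - 1}"]) auto
      moreover have "d S = (\<Sum>T\<in>Pow S. (-1) ^ (card S - card T) * ?f T)"
        using d S by (intro mobius_coefficient[of "{1..n - 1}"]) (auto intro: finite_subset)
      ultimately show "e S = restrict d (Pow {1..n - 1}) S"
        using S by simp
    qed simp
  qed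
  show "\<forall>d. fundamental_expansion n ?X d \<longrightarrow> (\<forall>k. 1 \<le> k \<and> k \<le> n \<longrightarrow> d {k..n - 1} =
      (\<Sum>D\<in>acyclic_orientations E. of_nat ((snk V D - 1) choose (k - 1)) * monom 1 (des \<zeta> D)))"
    using hook_coefficient[OF assms(1,2)] by blast
qed

end
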